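(* For all $A\subseteq\mathbb{Z}^+$, \[\mathrm{Dim}_\zeta(A)=\inf\{s\in[0,\infty)\mid \text{there is an } s\text{-gale } d \text{ that succeeds on every element of } A\}.\]
   Context: For $A\subseteq\mathbb{Z}^+$, $\mathrm{Dim}_\zeta(A)=\inf\{s\ge0\mid\sum_{n\in A}n^{-s}<\infty\}$. For $s\in[0,\infty)$, an $s$-gale is a function $d:\{0,1\}^*\to[0,\infty)$ satisfying $d(w)=2^{-s}[d(w0)+d(w1)]$ for all $w\in\{0,1\}^*$. An $s$-gale $d$ succeeds on a positive integer $n$ if $d(w)\ge1$, where $w$ is the standard binary representation (no leading zeros) of $n$. *)

theory Defs
  imports "HOL-Analysis.Analysis"
begin

(* The terms are nonnegative, so unconditional summability over A is finiteness of the sum.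
   The set is nonempty (it contains every s > 1) and bounded below, so the real-valued Inf
   is the genuine infimum. *)
definition zeta_dim :: "nat set \<Rightarrow> real" where
  "zeta_dim A = Inf {s. 0 \<le> s \<and> (\<lambda>n. real n powr (-s)) summable_on A}"

(* Binary strings are lists of bits, False for 0 and True for 1, read from left to right. *)
definition is_gale :: "real \<Rightarrow> (bool list \<Rightarrow> real) \<Rightarrow> bool" where
  "is_gale s d \<longleftrightarrow> (\<forall>w. 0 \<le> d w) \<and>
     (\<forall>w. d w = 2 powr (-s) * (d (w @ [False]) + d (w @ [True])))"

(* Most significant bit first and without leading zeros; 0 is sent to the empty string. *)
fun binary_rep :: "nat \<Rightarrow> bool list" where
  "binary_rep n = (if n = 0 then [] else binary_rep (n div 2) @ [odd n])"

declare binary_rep.simps [simp del]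

definition gale_succeeds_on :: "(bool list \<Rightarrow> real) \<Rightarrow> nat \<Rightarrow> bool" where
  "gale_succeeds_on d n \<longleftrightarrow> d (binary_rep n) \<ge> 1"

end

theory Submission
  imports Defs
begin

text \<open>
  An \<open>s\<close>-gale is \<open>2\<close> to the power \<open>s * length w\<close> times an additive weight on cylinders of the
  Cantor space. If \<open>n\<close> to the power \<open>-s\<close> is summable over \<open>A\<close>, put for every \<open>n\<close> in \<open>A\<close> a point
  mass \<open>2\<close> to the power \<open>-s * length (binary_rep n)\<close> on the sequence \<open>binary_rep n\<close> continued by
  zeros; the associated \<open>s\<close>-gale succeeds on \<open>A\<close>. Conversely the values of an \<open>s\<close>-gale on the words
  of length \<open>k\<close> add up to a constant times \<open>2\<close> to the power \<open>s * k\<close>, so for \<open>t > s\<close> the gale, damped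
  by \<open>2\<close> to the power \<open>-t * length w\<close>, is summable over all words by comparison with a geometric
  series; on \<open>A\<close> it dominates \<open>n\<close> to the power \<open>-t\<close> up to a constant.
\<close>

section \<open>Binary representations\<close>

lemma binary_rep_0 [simp]: "binary_rep 0 = []"
  by (simp add: binary_rep.simps)

lemma binary_rep_pos: "n > 0 \<Longrightarrow> binary_rep n = binary_rep (n div 2) @ [odd n]"
  by (subst binary_rep.simps) simp

text \<open>Horner evaluation of the bits supplies a left inverse of \<open>binary_rep\<close>,
  which yields injectivity.\<close>

lemma foldl_binary_rep: "foldl (\<lambda>a b. 2 * a + of_bool b) 0 (binary_rep n) = n"
proof (induction n rule: less_induct)
  case (less n)
  show ?case
  proof (cases "n = 0")
    case False
    then have "foldl (\<lambda>a b. 2 * a + of_bool b) 0 (binary_rep (n div 2)) = n div 2"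
      by (intro less) simp
    with False show ?thesis
      by (simp add: binary_rep_pos[of n])
  qed simp
qed

lemma inj_binary_rep: "inj binary_rep"
  by (rule inj_on_inverseI) (rule foldl_binary_rep)

lemma less_power_length_binary_rep: "n < 2 ^ length (binary_rep n)"
proof (induction n rule: less_induct)
  case (less n)
  show ?case
  proof (cases "n = 0")
    case False
    then have "n div 2 < 2 ^ length (binary_rep (n div 2))"
      by (intro less) simp
    with False show ?thesis
      by (simp add: binary_rep_pos[of n])
  qed simp
qed

lemma power_length_binary_rep_le: "n > 0 \<Longrightarrow> 2 ^ length (binary_rep n) \<le> 2 * n"
proof (induction n rule: less_induct)
  case (less n)
  show ?case
  proof (cases "n = 1")
    case True
    then show ?thesis
      by (simp add: binary_rep_pos[of "Suc 0"])
  next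
    case False
    with less.prems have "2 ^ length (binary_rep (n div 2)) \<le> 2 * (n div 2)"
      by (intro less) auto
    with less.prems show ?thesis
      by (simp add: binary_rep_pos[of n])
  qed
qed

lemma two_powr_length_binary_rep_le:
  fixes s :: real
  assumes "n > 0" "0 \<le> s"
  shows "2 powr (- s * length (binary_rep n)) \<le> real n powr (- s)"
proof -
  have "real n \<le> real (2 ^ length (binary_rep n))"
    using less_power_length_binary_rep[of n] by (intro of_nat_mono) simp
  then have "(2 powr length (binary_rep n)) powr (- s) \<le> real n powr (- s)"
    using assms by (intro powr_mono2') (auto simp: powr_realpow)
  then show ?thesis
    by (simp add: powr_powr mult.commute)
qed

text \<open>The factor \<open>2 powr t\<close> is the price of having only half the power of two,
  \<open>2 ^ (length - 1)\<close>, below \<open>n\<close>.\<close>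

lemma powr_le_two_powr_length_binary_rep:
  assumes "n > 0" "0 \<le> t"
  shows "real n powr (- t) \<le> 2 powr t * 2 powr (- t * length (binary_rep n))"
proof -
  have "real (2 ^ length (binary_rep n)) \<le> real (2 * n)"
    using power_length_binary_rep_le[OF assms(1)] by (rule of_nat_mono)
  then have "2 powr (real (length (binary_rep n)) - 1) \<le> real n"
    by (simp add: powr_diff powr_realpow)
  then have "real n powr (- t) \<le> (2 powr (real (length (binary_rep n)) - 1)) powr (- t)"
    using assms by (intro powr_mono2') auto
  also have "\<dots> = 2 powr t * 2 powr (- t * length (binary_rep n))"
    by (simp add: powr_powr powr_add[symmetric] algebra_simps)
  finally show ?thesis .
qed

section \<open>Summability of damped gales\<close>

lemma is_gale_nonneg: "is_gale s d \<Longrightarrow> 0 \<le> d w"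
  unfolding is_gale_def by blast

lemma is_gale_step: "is_gale s d \<Longrightarrow> d (w @ [False]) + d (w @ [True]) = 2 powr s * d w"
proof -
  assume "is_gale s d"
  then have "d w = 2 powr (- s) * (d (w @ [False]) + d (w @ [True]))"
    unfolding is_gale_def by blast
  moreover have "2 powr s * 2 powr (- s) = (1 :: real)"
    by (simp add: powr_add[symmetric])
  ultimately show ?thesis
    by (simp add: mult.assoc[symmetric])
qed

lemma finite_words_of_length: "finite {w :: bool list. length w = k}"
  using finite_lists_length_eq[of "UNIV :: bool set" k] by simp

text \<open>The new bit is split off at the end of the word, where the gale condition
  branches.\<close>

lemma words_of_length_Suc:
  "{w :: bool list. length w = Suc k} =
    (\<lambda>w. w @ [False]) ` {w. length w = k} \<union> (\<lambda>w. w @ [True]) ` {w. length w = k}"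
  (is "?L = ?R")
proof
  show "?L \<subseteq> ?R"
  proof
    fix w :: "bool list" assume "w \<in> ?L"
    then have "w = butlast w @ [last w]" "length (butlast w) = k"
      by (auto intro!: append_butlast_last_id[symmetric])
    then show "w \<in> ?R"
      by (cases "last w") (auto simp: image_iff intro: exI[of _ "butlast w"])
  qed
qed auto

lemma sum_gale_words_of_length:
  assumes "is_gale s d"
  shows "(\<Sum>w | length w = k. d w) = 2 powr (s * k) * d []"
proof (induction k)
  case (Suc k)
  have "(\<Sum>w | length w = Suc k. d w) =
      (\<Sum>w | length w = k. d (w @ [False])) + (\<Sum>w | length w = k. d (w @ [True]))"
    unfolding words_of_length_Suc
    by (subst sum.union_disjoint)
      (auto simp: finite_words_of_length sum.reindex inj_on_def)
  also have "\<dots> = 2 powr s * (\<Sum>w | length w = k. d w)"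
    by (simp add: sum.distrib[symmetric] is_gale_step[OF assms] sum_distrib_left)
  finally show ?case
    by (simp add: Suc algebra_simps powr_add)
qed simp

lemma damped_gale_summable:
  assumes gale: "is_gale s d" and "s < t"
  shows "(\<lambda>w. d w * 2 powr (- t * length w)) summable_on UNIV"
proof (rule nonneg_bdd_above_summable_on)
  define r :: real where "r = 2 powr (s - t)"
  have r: "0 < r" "r < 1"
    using \<open>s < t\<close> powr_less_mono[of "s - t" 0 2] by (auto simp: r_def)
  have le: "(\<Sum>w\<in>F. d w * 2 powr (- t * length w)) \<le> d [] * (1 / (1 - r))"
    if "finite F" for F
  proof -
    \<comment> \<open>\<open>insert 0\<close> keeps \<open>Max\<close> meaningful for empty
      \<open>F\<close>; \<open>Suc\<close> makes the bound strict, as summation over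
      \<open>k<K\<close> requires.\<close>
    define K where "K = Suc (Max (insert 0 (length ` F)))"
    have K: "length w < K" if "w \<in> F" for w
      using that \<open>finite F\<close> by (auto simp: K_def less_Suc_eq_le intro!: Max_ge)
    \<comment> \<open>Group \<open>F\<close> by word length, then enlarge each group to all words of
      that length, whose total is known.\<close>
    have "(\<Sum>w\<in>F. d w * 2 powr (- t * length w)) =
        (\<Sum>k<K. \<Sum>w | w \<in> F \<and> length w = k. d w * 2 powr (- t * length w))"
      using K \<open>finite F\<close> by (intro sum.group[symmetric]) auto
    also have "\<dots> \<le> (\<Sum>k<K. \<Sum>w | length w = k. d w * 2 powr (- t * length w))"
      by (intro sum_mono sum_mono2)
        (auto simp: finite_words_of_length is_gale_nonneg[OF gale])
    also have "\<dots> = (\<Sum>k<K. (\<Sum>w | length w = k. d w) * 2 powr (- t * k))"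
      by (simp add: sum_distrib_right)
    also have "\<dots> = (\<Sum>k<K. d [] * r ^ k)"
    proof (rule sum.cong)
      fix k
      have "r ^ k = 2 powr (s * k) * 2 powr (- t * k)"
        by (simp add: r_def powr_realpow[symmetric] powr_powr powr_add[symmetric] algebra_simps)
      then show "(\<Sum>w | length w = k. d w) * 2 powr (- t * k) = d [] * r ^ k"
        by (simp add: sum_gale_words_of_length[OF gale])
    qed simp
    also have "\<dots> = d [] * (\<Sum>k<K. r ^ k)"
      by (simp add: sum_distrib_left)
    also have "\<dots> \<le> d [] * (\<Sum>k. r ^ k)"
      using r is_gale_nonneg[OF gale]
      by (intro mult_left_mono sum_le_suminf summable_geometric) auto
    also have "\<dots> = d [] * (1 / (1 - r))"
      using r by (simp add: suminf_geometric)
    finally show ?thesis .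
  qed
  show "bdd_above (sum (\<lambda>w. d w * 2 powr (- t * length w)) ` {F. F \<subseteq> UNIV \<and> finite F})"
    using le by (intro bdd_aboveI2) auto
qed (simp add: is_gale_nonneg[OF gale])

lemma gale_success_imp_summable:
  assumes gale: "is_gale s d" and "0 \<le> s" "s < t"
    and A: "A \<subseteq> {n. n > 0}" and succ: "\<forall>n\<in>A. gale_succeeds_on d n"
  shows "(\<lambda>n. real n powr (- t)) summable_on A"
proof (rule summable_on_comparison_test)
  \<comment> \<open>Injectivity of \<open>binary_rep\<close> turns summability over words into
    summability over \<open>A\<close>.\<close>
  have "(\<lambda>w. d w * 2 powr (- t * length w)) summable_on binary_rep ` A"
    using damped_gale_summable[OF gale \<open>s < t\<close>] by (rule summable_on_subset_banach) simp
  then have "(\<lambda>n. d (binary_rep n) * 2 powr (- t * length (binary_rep n))) summable_on A"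
    by (simp add: summable_on_reindex[OF inj_on_subset[OF inj_binary_rep]] o_def)
  then show "(\<lambda>n. 2 powr t * (d (binary_rep n) * 2 powr (- t * length (binary_rep n)))) summable_on A"
    by (rule summable_on_cmult_right)
next
  fix n assume "n \<in> A"
  then have "n > 0" and d: "1 \<le> d (binary_rep n)"
    using A succ by (auto simp: gale_succeeds_on_def)
  then have "real n powr (- t) \<le> 2 powr t * (1 * 2 powr (- t * length (binary_rep n)))"
    using powr_le_two_powr_length_binary_rep[of n t] \<open>0 \<le> s\<close> \<open>s < t\<close> by simp
  also have "\<dots> \<le> 2 powr t * (d (binary_rep n) * 2 powr (- t * length (binary_rep n)))"
    using d by (intro mult_left_mono mult_right_mono) auto
  finally show "real n powr (- t) \<le>
      2 powr t * (d (binary_rep n) * 2 powr (- t * length (binary_rep n)))" .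
qed simp

section \<open>The gale of a weighted set of words\<close>

text \<open>Padding gives prefixes of every length, so mass placed here survives every further
  branching.\<close>

definition zero_extension :: "bool list \<Rightarrow> nat \<Rightarrow> bool" where
  "zero_extension w i \<longleftrightarrow> i < length w \<and> w ! i"

definition initial_word :: "(nat \<Rightarrow> bool) \<Rightarrow> nat \<Rightarrow> bool list" where
  "initial_word x k = map x [0..<k]"

lemma initial_word_zero_extension: "initial_word (zero_extension w) (length w) = w"
  by (auto simp: initial_word_def zero_extension_def intro: nth_equalityI)

text \<open>The image of the weight \<open>m\<close> under \<open>x\<close>, evaluated on the
  cylinder of \<open>w\<close>. Weights sit on indices because \<open>x\<close> may identify some:
  the words for 1 and 2 have the same zero extension.\<close>

definition cylinder_mass :: "('a \<Rightarrow> nat \<Rightarrow> bool) \<Rightarrow> ('a \<Rightarrow> real) \<Rightarrow> 'a set \<Rightarrow> bool list \<Rightarrow> real" where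
  "cylinder_mass x m A w = infsum m {a\<in>A. initial_word (x a) (length w) = w}"

lemma cylinder_mass_nonneg: "(\<And>a. a \<in> A \<Longrightarrow> 0 \<le> m a) \<Longrightarrow> 0 \<le> cylinder_mass x m A w"
  by (auto simp: cylinder_mass_def intro: infsum_nonneg)

text \<open>Every sequence through \<open>w\<close> continues with exactly one of the two bits.
  Summability rules out the default value 0 of \<open>infsum\<close>.\<close>

lemma cylinder_mass_split:
  assumes "m summable_on A"
  shows "cylinder_mass x m A w =
    cylinder_mass x m A (w @ [False]) + cylinder_mass x m A (w @ [True])"
proof -
  let ?C = "\<lambda>w. {a\<in>A. initial_word (x a) (length w) = w}"
  have "?C w = ?C (w @ [False]) \<union> ?C (w @ [True])"
    by (auto simp: initial_word_def)
  moreover have "?C (w @ [False]) \<inter> ?C (w @ [True]) = {}"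
    by auto
  moreover have "m summable_on ?C v" for v
    using assms by (rule summable_on_subset_banach) auto
  ultimately show ?thesis
    unfolding cylinder_mass_def by (simp only: infsum_Un_disjoint)
qed

lemma le_cylinder_mass:
  assumes "m summable_on A" "\<And>a. a \<in> A \<Longrightarrow> 0 \<le> m a"
    and "a \<in> A" "initial_word (x a) (length w) = w"
  shows "m a \<le> cylinder_mass x m A w"
proof -
  have "infsum m {a} \<le> infsum m {a\<in>A. initial_word (x a) (length w) = w}"
    using assms by (intro infsum_mono_neutral summable_on_subset_banach[OF assms(1)]) auto
  then show ?thesis
    by (simp add: cylinder_mass_def)
qed

lemma is_gale_cylinder_mass:
  assumes "m summable_on A" "\<And>a. a \<in> A \<Longrightarrow> 0 \<le> m a"
  shows "is_gale s (\<lambda>w. 2 powr (s * length w) * cylinder_mass x m A w)"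
  unfolding is_gale_def
proof (intro conjI allI)
  fix w
  show "0 \<le> 2 powr (s * length w) * cylinder_mass x m A w"
    using assms by (simp add: cylinder_mass_nonneg)
  have "2 powr (- s) * 2 powr (s * length (w @ [b])) = 2 powr (s * length w)" for b
    by (simp add: powr_add[symmetric] algebra_simps)
  then show "2 powr (s * length w) * cylinder_mass x m A w =
    2 powr (- s) * (2 powr (s * length (w @ [False])) * cylinder_mass x m A (w @ [False]) +
      2 powr (s * length (w @ [True])) * cylinder_mass x m A (w @ [True]))"
    by (simp only: cylinder_mass_split[OF assms(1), of x w] distrib_left mult.assoc[symmetric])
qed

lemma summable_imp_gale_success:
  fixes s :: real
  assumes "0 \<le> s" and A: "A \<subseteq> {n. n > 0}" and sum: "(\<lambda>n. real n powr (- s)) summable_on A"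
  shows "\<exists>d. is_gale s d \<and> (\<forall>n\<in>A. gale_succeeds_on d n)"
proof -
  define m :: "nat \<Rightarrow> real" where "m n = 2 powr (- s * length (binary_rep n))" for n
  define x where "x n = zero_extension (binary_rep n)" for n
  define d where "d w = 2 powr (s * length w) * cylinder_mass x m A w" for w
  have m: "m summable_on A"
    using sum
  proof (rule summable_on_comparison_test)
    fix n assume "n \<in> A"
    then show "m n \<le> real n powr (- s)"
      using A \<open>0 \<le> s\<close> two_powr_length_binary_rep_le[of n s] by (auto simp: m_def)
  qed (simp add: m_def)
  have "is_gale s d"
    unfolding d_def using m by (intro is_gale_cylinder_mass) (simp_all add: m_def)
  moreover have "gale_succeeds_on d n" if "n \<in> A" for n
  proof -
    \<comment> \<open>The sequence \<open>x n\<close> starts with \<open>binary_rep n\<close>, so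
      this cylinder contains the mass of \<open>n\<close>; the scaling in \<open>d\<close> turns
      that mass into exactly 1.\<close>
    have "m n \<le> cylinder_mass x m A (binary_rep n)"
      using m _ that by (rule le_cylinder_mass) (simp_all add: m_def x_def initial_word_zero_extension)
    then have "2 powr (s * length (binary_rep n)) * m n \<le> d (binary_rep n)"
      by (simp add: d_def)
    then show ?thesis
      by (simp add: gale_succeeds_on_def m_def powr_add[symmetric])
  qed
  ultimately show ?thesis
    by blast
qed

section \<open>Gale characterization of zeta dimension\<close>

theorem theorem5p5:
  fixes A :: "nat set"
  assumes "A \<subseteq> {n. n > 0}"
  shows "zeta_dim A =
    Inf {s::real. 0 \<le> s \<and> (\<exists>d. is_gale s d \<and> (\<forall>n\<in>A. gale_succeeds_on d n))}"
proof -
  define Z where "Z = {s. 0 \<le> s \<and> (\<lambda>n. real n powr (-s)) summable_on A}"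
  define G where "G = {s::real. 0 \<le> s \<and> (\<exists>d. is_gale s d \<and> (\<forall>n\<in>A. gale_succeeds_on d n))}"
  have bdd: "bdd_below Z" "bdd_below G"
    by (auto simp: Z_def G_def intro: bdd_belowI[of _ 0])
  \<comment> \<open>The exponent 2 witnesses that \<open>Z\<close>, and hence \<open>G\<close>, is
    nonempty, so that both values of \<open>Inf\<close> are genuine infima.\<close>
  have "summable (\<lambda>n. norm (real n powr (- 2)))"
    by (simp add: summable_real_powr_iff)
  then have "(\<lambda>n. real n powr (- 2)) summable_on A"
    by (rule summable_on_subset_banach[OF norm_summable_imp_summable_on]) simp
  then have "2 \<in> Z"
    by (simp add: Z_def)
  have "Z \<subseteq> G"
    using summable_imp_gale_success[OF _ assms] by (auto simp: Z_def G_def)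
  have "Inf Z \<le> Inf G"
  proof (rule cInf_greatest)
    show "G \<noteq> {}"
      using \<open>2 \<in> Z\<close> \<open>Z \<subseteq> G\<close> by blast
    fix s assume "s \<in> G"
    \<comment> \<open>Only exponents above \<open>s\<close> are claimed: for all positive integers
      and \<open>s = 1\<close> the constant gale 1 succeeds, yet the harmonic series diverges.
      Density of the reals closes the gap.\<close>
    then have "t \<in> Z" if "s < t" for t
      using that gale_success_imp_summable[OF _ _ that assms] by (auto simp: Z_def G_def)
    then show "Inf Z \<le> s"
      using cInf_lower[OF _ bdd(1)] by (intro dense_ge[of s]) blast
  qed
  moreover have "Inf G \<le> Inf Z"
    using \<open>2 \<in> Z\<close> \<open>Z \<subseteq> G\<close> bdd by (intro cInf_superset_mono) auto
  ultimately show ?thesis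
    by (simp add: zeta_dim_def Z_def G_def)
qed

end
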